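(* Let $(A,[\cdot,\cdot],\{\cdot,\cdot,\cdot\})$ be a Bol superalgebra and $\beta$ an even self-morphism of it. Define on $A$ $$[x,y]_\beta:=\beta([x,y]),\qquad \{x,y,z\}_\beta:=\beta^2(\{x,y,z\}).$$ Then $\mathcal A_\beta:=(A,[\cdot,\cdot]_\beta,\{\cdot,\cdot,\cdot\}_\beta,\beta)$ is a Hom-Bol superalgebra. Moreover, if $(A',[\cdot,\cdot]',\{\cdot,\cdot,\cdot\}')$ is another Bol superalgebra, $\beta'$ an even self-morphism of it, and $f:A\to A'$ an even morphism of Bol superalgebras satisfying $f\circ\beta=\beta'\circ f$, then $f:\mathcal A_\beta\to\mathcal A'_{\beta'}$ is a morphism of Hom-Bol superalgebras, where $\mathcal A'_{\beta'}:=(A',[\cdot,\cdot]'_{\beta'},\{\cdot,\cdot,\cdot\}'_{\beta'},\beta')$ with $[x,y]'_{\beta'}:=\beta'([x,y]')$ and $\{x,y,z\}'_{\beta'}:=\beta'^2(\{x,y,z\}')$.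
   Context: All vector spaces are over a fixed field of characteristic not $2$ or $3$. A superspace is a $\mathbb Z_2$-graded vector space $A=A_0\oplus A_1$; $\bar x$ is the degree of a homogeneous $x$. A linear map is even if it preserves degrees. A Hom-Bol superalgebra is a quadruple $(A,[\cdot,\cdot],\{\cdot,\cdot,\cdot\},\alpha)$ with $A$ a superspace, $[\cdot,\cdot]$ bilinear, $\{\cdot,\cdot,\cdot\}$ trilinear, $\alpha:A\to A$ even linear, $[A_i,A_j]\subseteq A_{i+j}$, $\{A_i,A_j,A_k\}\subseteq A_{i+j+k}$, and for all homogeneous $u,v,w,x,y,z$: (SHB01) $\alpha([x,y])=[\alpha(x),\alpha(y)]$; (SHB02) $\alpha(\{x,y,z\})=\{\alpha(x),\alpha(y),\alpha(z)\}$; (SHB1) $[x,y]=-(-1)^{\bar x\bar y}[y,x]$; (SHB2) $\{x,y,z\}=-(-1)^{\bar x\bar y}\{y,x,z\}$; (SHB3) $\{x,y,z\}+(-1)^{\bar x(\bar y+\bar z)}\{y,z,x\}+(-1)^{\bar z(\bar x+\bar y)}\{z,x,y\}=0$; (SHB4) $\{\alpha(x),\alpha(y),[u,v]\}=[\{x,y,u\},\alpha^2(v)]+(-1)^{\bar u(\bar x+\bar y)}[\alpha^2(u),\{x,y,v\}]+(-1)^{(\bar x+\bar y)(\bar u+\bar v)}\big(\{\alpha(u),\alpha(v),[x,y]\}-[[\alpha(u),\alpha(v)],[\alpha(x),\alpha(y)]]\big)$; (SHB5) $\{\alpha^2(x),\alpha^2(y),\{u,v,w\}\}=\{\{x,y,u\},\alpha^2(v),\alpha^2(w)\}+(-1)^{\bar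 u(\bar x+\bar y)}\{\alpha^2(u),\{x,y,v\},\alpha^2(w)\}+(-1)^{(\bar x+\bar y)(\bar u+\bar v)}\{\alpha^2(u),\alpha^2(v),\{x,y,w\}\}$. A Bol superalgebra is a triple $(A,[\cdot,\cdot],\{\cdot,\cdot,\cdot\})$ such that $(A,[\cdot,\cdot],\{\cdot,\cdot,\cdot\},\mathrm{Id})$ is a Hom-Bol superalgebra. A morphism of Bol superalgebras is a linear map compatible with the binary and ternary operations; a morphism of Hom-Bol superalgebras is moreover compatible with the twisting maps. *)

theory Defs
  imports Complex_Main "HOL-Library.Z2"
begin

text \<open>
  The underlying vector space of a superspace is a whole type with scalar multiplication
  \<open>scale\<close>; the grading is a family of subspaces \<open>V\<close> indexed by \<^typ>\<open>bit\<close>, the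
  two-element field, so that sums and products of degrees are taken modulo 2.
\<close>

locale superspace = vector_space scale
  for scale :: "'k::field \<Rightarrow> 'v::ab_group_add \<Rightarrow> 'v" (infixr \<open>*s\<close> 75) +
  fixes V :: "bit \<Rightarrow> 'v set"
  assumes subspace_V: "subspace (V i)"
    and V_inter: "V 0 \<inter> V 1 = {0}"
    and V_sum: "\<exists>a\<in>V 0. \<exists>b\<in>V 1. x = a + b"

definition even_map :: "(bit \<Rightarrow> 'v set) \<Rightarrow> (bit \<Rightarrow> 'w set) \<Rightarrow> ('v \<Rightarrow> 'w) \<Rightarrow> bool" where
  "even_map V W f \<longleftrightarrow> (\<forall>i. \<forall>x\<in>V i. f x \<in> W i)"

text \<open>The scalar \<open>(-1)\<^sup>e\<close> for an exponent \<open>e\<close> modulo 2.\<close>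

definition ksign :: "bit \<Rightarrow> 'k::field" where
  "ksign e = (if e = 0 then 1 else - 1)"

text \<open>
  In each identity the degree of a homogeneous element is named by the index of the component
  containing it. The zero vector lies in both components, but by multilinearity the identities
  hold trivially as soon as one of the variables is zero.
\<close>

locale hom_bol_superalgebra = superspace scale V
  for scale :: "'k::field \<Rightarrow> 'v::ab_group_add \<Rightarrow> 'v" (infixr \<open>*s\<close> 75)
    and V :: "bit \<Rightarrow> 'v set" +
  fixes br :: "'v \<Rightarrow> 'v \<Rightarrow> 'v" (\<open>\<lbrakk>_, _\<rbrakk>\<close>)
    and tr :: "'v \<Rightarrow> 'v \<Rightarrow> 'v \<Rightarrow> 'v" (\<open>\<lbrace>_, _, _\<rbrace>\<close>)
    and \<alpha> :: "'v \<Rightarrow> 'v"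
  assumes br_linear1: "Vector_Spaces.linear scale scale (\<lambda>x. \<lbrakk>x, y\<rbrakk>)"
    and br_linear2: "Vector_Spaces.linear scale scale (\<lambda>y. \<lbrakk>x, y\<rbrakk>)"
    and tr_linear1: "Vector_Spaces.linear scale scale (\<lambda>x. \<lbrace>x, y, z\<rbrace>)"
    and tr_linear2: "Vector_Spaces.linear scale scale (\<lambda>y. \<lbrace>x, y, z\<rbrace>)"
    and tr_linear3: "Vector_Spaces.linear scale scale (\<lambda>z. \<lbrace>x, y, z\<rbrace>)"
    and alpha_linear: "Vector_Spaces.linear scale scale \<alpha>"
    and alpha_even: "even_map V V \<alpha>"
    and br_degree: "x \<in> V i \<Longrightarrow> y \<in> V j \<Longrightarrow> \<lbrakk>x, y\<rbrakk> \<in> V (i + j)"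
    and tr_degree: "x \<in> V i \<Longrightarrow> y \<in> V j \<Longrightarrow> z \<in> V k \<Longrightarrow> \<lbrace>x, y, z\<rbrace> \<in> V (i + j + k)"
    and SHB01: "x \<in> V i \<Longrightarrow> y \<in> V j \<Longrightarrow> \<alpha> \<lbrakk>x, y\<rbrakk> = \<lbrakk>\<alpha> x, \<alpha> y\<rbrakk>"
    and SHB02: "x \<in> V i \<Longrightarrow> y \<in> V j \<Longrightarrow> z \<in> V k \<Longrightarrow> \<alpha> \<lbrace>x, y, z\<rbrace> = \<lbrace>\<alpha> x, \<alpha> y, \<alpha> z\<rbrace>"
    and SHB1: "x \<in> V i \<Longrightarrow> y \<in> V j \<Longrightarrow> \<lbrakk>x, y\<rbrakk> = - (ksign (i * j) *s \<lbrakk>y, x\<rbrakk>)"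
    and SHB2: "x \<in> V i \<Longrightarrow> y \<in> V j \<Longrightarrow> z \<in> V k \<Longrightarrow>
      \<lbrace>x, y, z\<rbrace> = - (ksign (i * j) *s \<lbrace>y, x, z\<rbrace>)"
    and SHB3: "x \<in> V i \<Longrightarrow> y \<in> V j \<Longrightarrow> z \<in> V k \<Longrightarrow>
      \<lbrace>x, y, z\<rbrace> + ksign (i * (j + k)) *s \<lbrace>y, z, x\<rbrace> + ksign (k * (i + j)) *s \<lbrace>z, x, y\<rbrace> = 0"
    and SHB4: "x \<in> V i \<Longrightarrow> y \<in> V j \<Longrightarrow> u \<in> V p \<Longrightarrow> v \<in> V q \<Longrightarrow>
      \<lbrace>\<alpha> x, \<alpha> y, \<lbrakk>u, v\<rbrakk>\<rbrace> =
        \<lbrakk>\<lbrace>x, y, u\<rbrace>, (\<alpha> ^^ 2) v\<rbrakk>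
        + ksign (p * (i + j)) *s \<lbrakk>(\<alpha> ^^ 2) u, \<lbrace>x, y, v\<rbrace>\<rbrakk>
        + ksign ((i + j) * (p + q)) *s
            (\<lbrace>\<alpha> u, \<alpha> v, \<lbrakk>x, y\<rbrakk>\<rbrace> - \<lbrakk>\<lbrakk>\<alpha> u, \<alpha> v\<rbrakk>, \<lbrakk>\<alpha> x, \<alpha> y\<rbrakk>\<rbrakk>)"
    and SHB5: "x \<in> V i \<Longrightarrow> y \<in> V j \<Longrightarrow> u \<in> V p \<Longrightarrow> v \<in> V q \<Longrightarrow> w \<in> V r \<Longrightarrow>
      \<lbrace>(\<alpha> ^^ 2) x, (\<alpha> ^^ 2) y, \<lbrace>u, v, w\<rbrace>\<rbrace> =
        \<lbrace>\<lbrace>x, y, u\<rbrace>, (\<alpha> ^^ 2) v, (\<alpha> ^^ 2) w\<rbrace>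
        + ksign (p * (i + j)) *s \<lbrace>(\<alpha> ^^ 2) u, \<lbrace>x, y, v\<rbrace>, (\<alpha> ^^ 2) w\<rbrace>
        + ksign ((i + j) * (p + q)) *s \<lbrace>(\<alpha> ^^ 2) u, (\<alpha> ^^ 2) v, \<lbrace>x, y, w\<rbrace>\<rbrace>"

definition bol_superalgebra ::
  "('k::field \<Rightarrow> 'v::ab_group_add \<Rightarrow> 'v) \<Rightarrow> (bit \<Rightarrow> 'v set) \<Rightarrow>
    ('v \<Rightarrow> 'v \<Rightarrow> 'v) \<Rightarrow> ('v \<Rightarrow> 'v \<Rightarrow> 'v \<Rightarrow> 'v) \<Rightarrow> bool" where
  "bol_superalgebra scale V br tr \<longleftrightarrow> hom_bol_superalgebra scale V br tr id"

text \<open>Morphisms are not required to be even; evenness is a separate condition.\<close>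

locale bol_morphism =
  Vector_Spaces.linear scale scale' f
  for scale :: "'k::field \<Rightarrow> 'v::ab_group_add \<Rightarrow> 'v"
    and V :: "bit \<Rightarrow> 'v set"
    and br :: "'v \<Rightarrow> 'v \<Rightarrow> 'v"
    and tr :: "'v \<Rightarrow> 'v \<Rightarrow> 'v \<Rightarrow> 'v"
    and scale' :: "'k \<Rightarrow> 'w::ab_group_add \<Rightarrow> 'w"
    and V' :: "bit \<Rightarrow> 'w set"
    and br' :: "'w \<Rightarrow> 'w \<Rightarrow> 'w"
    and tr' :: "'w \<Rightarrow> 'w \<Rightarrow> 'w \<Rightarrow> 'w"
    and f :: "'v \<Rightarrow> 'w" +
  assumes source: "bol_superalgebra scale V br tr"
    and target: "bol_superalgebra scale' V' br' tr'"
    and map_br: "f (br x y) = br' (f x) (f y)"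
    and map_tr: "f (tr x y z) = tr' (f x) (f y) (f z)"

locale hom_bol_morphism =
  Vector_Spaces.linear scale scale' f
  for scale :: "'k::field \<Rightarrow> 'v::ab_group_add \<Rightarrow> 'v"
    and V :: "bit \<Rightarrow> 'v set"
    and br :: "'v \<Rightarrow> 'v \<Rightarrow> 'v"
    and tr :: "'v \<Rightarrow> 'v \<Rightarrow> 'v \<Rightarrow> 'v"
    and \<alpha> :: "'v \<Rightarrow> 'v"
    and scale' :: "'k \<Rightarrow> 'w::ab_group_add \<Rightarrow> 'w"
    and V' :: "bit \<Rightarrow> 'w set"
    and br' :: "'w \<Rightarrow> 'w \<Rightarrow> 'w"
    and tr' :: "'w \<Rightarrow> 'w \<Rightarrow> 'w \<Rightarrow> 'w"
    and \<alpha>' :: "'w \<Rightarrow> 'w"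
    and f :: "'v \<Rightarrow> 'w" +
  assumes source: "hom_bol_superalgebra scale V br tr \<alpha>"
    and target: "hom_bol_superalgebra scale' V' br' tr' \<alpha>'"
    and map_br: "f (br x y) = br' (f x) (f y)"
    and map_tr: "f (tr x y z) = tr' (f x) (f y) (f z)"
    and map_twist: "f \<circ> \<alpha> = \<alpha>' \<circ> f"

definition twist_br :: "('v \<Rightarrow> 'v) \<Rightarrow> ('v \<Rightarrow> 'v \<Rightarrow> 'v) \<Rightarrow> 'v \<Rightarrow> 'v \<Rightarrow> 'v" where
  "twist_br \<beta> br x y = \<beta> (br x y)"

definition twist_tr :: "('v \<Rightarrow> 'v) \<Rightarrow> ('v \<Rightarrow> 'v \<Rightarrow> 'v \<Rightarrow> 'v) \<Rightarrow> 'v \<Rightarrow> 'v \<Rightarrow> 'v \<Rightarrow> 'v" where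
  "twist_tr \<beta> tr x y z = (\<beta> ^^ 2) (tr x y z)"

end

theory Submission
  imports Defs
begin

text \<open>
  Since \<open>\<beta>\<close> commutes with both operations, each identity of the twisted structure is the image
  of the corresponding untwisted identity under a power of \<open>\<beta>\<close>: the first power for (SHB1),
  the second for (SHB2) and (SHB3), the third for (SHB4) and the fourth for (SHB5).
\<close>

lemma hom_bol_superalgebra_twist:
  assumes "bol_superalgebra scale V br tr"
    and "bol_morphism scale V br tr scale V br tr \<beta>"
    and "even_map V V \<beta>"
  shows "hom_bol_superalgebra scale V (twist_br \<beta> br) (twist_tr \<beta> tr) \<beta>"
proof -
  \<comment> \<open>The Bol identities arrive as Hom-Bol identities with twisting map
    \<open>id\<close>. The stray \<open>id\<close> and \<open>id ^^ 2\<close> in (SHB4) and (SHB5)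
    vanish later through \<open>funpow.simps\<close>, \<open>o_apply\<close> and
    \<open>id_apply\<close>.\<close>
  interpret A: hom_bol_superalgebra scale V br tr id
    using assms(1) by (simp add: bol_superalgebra_def)
  interpret \<beta>: bol_morphism scale V br tr scale V br tr \<beta>
    by (rule assms(2))
  note twist = twist_br_def twist_tr_def numeral_2_eq_2
  \<comment> \<open>Rewriting with \<open>push\<close> carries every \<beta> down to the variables.
    Two expressions agree in this normal form once each variable has collected the same number of
    \<beta>'s on both sides.\<close>
  note push = \<beta>.map_br \<beta>.map_tr \<beta>.add \<beta>.scale \<beta>.neg \<beta>.diff \<beta>.zero
  have \<beta>: "Vector_Spaces.linear scale scale \<beta>"
    by (rule \<beta>.linear_axioms)
  \<comment> \<open>The twisted operations are the old ones followed by \<beta> or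
    \<open>\<beta> ^^ 2\<close>, so linearity in each slot is a composition of linear maps.\<close>
  have \<beta>2: "Vector_Spaces.linear scale scale (\<beta> ^^ 2)"
    using Vector_Spaces.linear_compose[OF \<beta> \<beta>] by (simp add: numeral_2_eq_2)
  have even: "\<beta> x \<in> V i" if "x \<in> V i" for x i
    using assms(3) that by (simp add: even_map_def)
  show ?thesis
  proof (intro hom_bol_superalgebra.intro hom_bol_superalgebra_axioms.intro)
    show "superspace scale V"
      by (rule A.superspace_axioms)
    show "Vector_Spaces.linear scale scale (\<lambda>x. twist_br \<beta> br x y)" for y
      using Vector_Spaces.linear_compose[OF A.br_linear1 \<beta>] by (simp add: twist_br_def o_def)
    show "Vector_Spaces.linear scale scale (\<lambda>y. twist_br \<beta> br x y)" for x
      using Vector_Spaces.linear_compose[OF A.br_linear2 \<beta>] by (simp add: twist_br_def o_def)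
    show "Vector_Spaces.linear scale scale (\<lambda>x. twist_tr \<beta> tr x y z)" for y z
      using Vector_Spaces.linear_compose[OF A.tr_linear1 \<beta>2] by (simp add: twist_tr_def o_def)
    show "Vector_Spaces.linear scale scale (\<lambda>y. twist_tr \<beta> tr x y z)" for x z
      using Vector_Spaces.linear_compose[OF A.tr_linear2 \<beta>2] by (simp add: twist_tr_def o_def)
    show "Vector_Spaces.linear scale scale (\<lambda>z. twist_tr \<beta> tr x y z)" for x y
      using Vector_Spaces.linear_compose[OF A.tr_linear3 \<beta>2] by (simp add: twist_tr_def o_def)
    show "Vector_Spaces.linear scale scale \<beta>"
      by (rule \<beta>)
    show "even_map V V \<beta>"
      by (rule assms(3))
  next
    fix x y i j
    assume xy: "x \<in> V i" "y \<in> V j"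
    show "twist_br \<beta> br x y \<in> V (i + j)"
      unfolding twist_br_def by (intro even A.br_degree xy)
    show "\<beta> (twist_br \<beta> br x y) = twist_br \<beta> br (\<beta> x) (\<beta> y)"
      by (simp add: twist_br_def \<beta>.map_br)
    \<comment> \<open>Here and below the untwisted identity is taken at the original variables and
      \<beta> is applied afterwards, so the signs carry over unchanged.\<close>
    show "twist_br \<beta> br x y = - scale (ksign (i * j)) (twist_br \<beta> br y x)"
      using arg_cong[OF A.SHB1[OF xy], of \<beta>] by (simp only: twist push)
    fix z k
    assume z: "z \<in> V k"
    show "twist_tr \<beta> tr x y z \<in> V (i + j + k)"
      unfolding twist funpow.simps o_apply id_apply by (intro even A.tr_degree xy z)
    show "\<beta> (twist_tr \<beta> tr x y z) = twist_tr \<beta> tr (\<beta> x) (\<beta> y) (\<beta> z)"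
      by (simp add: twist \<beta>.map_tr)
    show "twist_tr \<beta> tr x y z = - scale (ksign (i * j)) (twist_tr \<beta> tr y x z)"
      using arg_cong[OF A.SHB2[OF xy z], of "\<beta> ^^ 2"]
      by (simp only: twist push funpow.simps o_apply id_apply)
    show "twist_tr \<beta> tr x y z
        + scale (ksign (i * (j + k))) (twist_tr \<beta> tr y z x)
        + scale (ksign (k * (i + j))) (twist_tr \<beta> tr z x y) = 0"
      using arg_cong[OF A.SHB3[OF xy z], of "\<beta> ^^ 2"]
      by (simp only: twist push funpow.simps o_apply id_apply)
  next
    fix x y u v i j p q
    assume xyuv: "x \<in> V i" "y \<in> V j" "u \<in> V p" "v \<in> V q"
    \<comment> \<open>Every term gives each variable three \<beta>'s: for instance, on the left two
      come from the outer ternary product and one from the argument \<beta> x, \<beta> y or the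
      inner bracket. In the double bracket, each of the two nested brackets contributes one and the
      argument another.\<close>
    show "twist_tr \<beta> tr (\<beta> x) (\<beta> y) (twist_br \<beta> br u v) =
        twist_br \<beta> br (twist_tr \<beta> tr x y u) ((\<beta> ^^ 2) v)
        + scale (ksign (p * (i + j))) (twist_br \<beta> br ((\<beta> ^^ 2) u) (twist_tr \<beta> tr x y v))
        + scale (ksign ((i + j) * (p + q)))
            (twist_tr \<beta> tr (\<beta> u) (\<beta> v) (twist_br \<beta> br x y)
             - twist_br \<beta> br (twist_br \<beta> br (\<beta> u) (\<beta> v)) (twist_br \<beta> br (\<beta> x) (\<beta> y)))"
      using arg_cong[OF A.SHB4[OF xyuv], of "\<beta> ^^ 3"]
      by (simp only: twist numeral_3_eq_3 push funpow.simps o_apply id_apply)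
    fix w r
    assume w: "w \<in> V r"
    \<comment> \<open>In every term the outer product contributes two \<beta>'s, and either the
      inner product or the twisted argument two more. The fourth power is written out as nested
      applications, so its exponent needs no unfolding.\<close>
    show "twist_tr \<beta> tr ((\<beta> ^^ 2) x) ((\<beta> ^^ 2) y) (twist_tr \<beta> tr u v w) =
        twist_tr \<beta> tr (twist_tr \<beta> tr x y u) ((\<beta> ^^ 2) v) ((\<beta> ^^ 2) w)
        + scale (ksign (p * (i + j)))
            (twist_tr \<beta> tr ((\<beta> ^^ 2) u) (twist_tr \<beta> tr x y v) ((\<beta> ^^ 2) w))
        + scale (ksign ((i + j) * (p + q)))
            (twist_tr \<beta> tr ((\<beta> ^^ 2) u) ((\<beta> ^^ 2) v) (twist_tr \<beta> tr x y w))"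
      using arg_cong[OF A.SHB5[OF xyuv w], of "\<lambda>t. \<beta> (\<beta> (\<beta> (\<beta> t)))"]
      by (simp only: twist push funpow.simps o_apply id_apply)
  qed
qed

text \<open>Each twisted operation is the old one followed by a power of \<beta>; as f intertwines
  \<beta> with \<beta>', it can be moved past that power one factor at a time and then through the
  old operation.\<close>

lemma hom_bol_morphism_twist:
  assumes "bol_morphism scale V br tr scale V br tr \<beta>" "even_map V V \<beta>"
    and "bol_morphism scale' V' br' tr' scale' V' br' tr' \<beta>'" "even_map V' V' \<beta>'"
    and "bol_morphism scale V br tr scale' V' br' tr' f"
    and comm: "f \<circ> \<beta> = \<beta>' \<circ> f"
  shows "hom_bol_morphism
    scale V (twist_br \<beta> br) (twist_tr \<beta> tr) \<beta>
    scale' V' (twist_br \<beta>' br') (twist_tr \<beta>' tr') \<beta>' f"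
proof -
  interpret f: bol_morphism scale V br tr scale' V' br' tr' f
    by (rule assms(5))
  have f\<beta>: "f (\<beta> x) = \<beta>' (f x)" for x
    using fun_cong[OF comm, of x] by simp
  show ?thesis
  proof (intro hom_bol_morphism.intro hom_bol_morphism_axioms.intro)
    show "Vector_Spaces.linear scale scale' f"
      by (rule f.linear_axioms)
    \<comment> \<open>That both ends are Bol superalgebras is part of f being a Bol morphism, so the
      twisting lemma applies to each of them.\<close>
    show "hom_bol_superalgebra scale V (twist_br \<beta> br) (twist_tr \<beta> tr) \<beta>"
      by (rule hom_bol_superalgebra_twist[OF f.source assms(1,2)])
    show "hom_bol_superalgebra scale' V' (twist_br \<beta>' br') (twist_tr \<beta>' tr') \<beta>'"
      by (rule hom_bol_superalgebra_twist[OF f.target assms(3,4)])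
    show "f (twist_br \<beta> br x y) = twist_br \<beta>' br' (f x) (f y)" for x y
      by (simp add: twist_br_def f\<beta> f.map_br)
    show "f (twist_tr \<beta> tr x y z) = twist_tr \<beta>' tr' (f x) (f y) (f z)" for x y z
      by (simp add: twist_tr_def numeral_2_eq_2 f\<beta> f.map_tr)
    show "f \<circ> \<beta> = \<beta>' \<circ> f"
      by (rule comm)
  qed
qed

theorem corollary5p1:
  fixes scale :: "'k::field \<Rightarrow> 'v::ab_group_add \<Rightarrow> 'v"
    and V :: "bit \<Rightarrow> 'v set"
    and br :: "'v \<Rightarrow> 'v \<Rightarrow> 'v"
    and tr :: "'v \<Rightarrow> 'v \<Rightarrow> 'v \<Rightarrow> 'v"
    and \<beta> :: "'v \<Rightarrow> 'v"
  assumes "CHAR('k) \<noteq> 2" and "CHAR('k) \<noteq> 3"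
    and "bol_superalgebra scale V br tr"
    and "bol_morphism scale V br tr scale V br tr \<beta>"
    and "even_map V V \<beta>"
  shows "hom_bol_superalgebra scale V (twist_br \<beta> br) (twist_tr \<beta> tr) \<beta> \<and>
    (\<forall>(scale' :: 'k \<Rightarrow> 'w::ab_group_add \<Rightarrow> 'w) V' br' tr' \<beta>' f.
      bol_superalgebra scale' V' br' tr' \<longrightarrow>
      bol_morphism scale' V' br' tr' scale' V' br' tr' \<beta>' \<longrightarrow>
      even_map V' V' \<beta>' \<longrightarrow>
      bol_morphism scale V br tr scale' V' br' tr' f \<longrightarrow>
      even_map V V' f \<longrightarrow>
      f \<circ> \<beta> = \<beta>' \<circ> f \<longrightarrow>
      hom_bol_morphism
        scale V (twist_br \<beta> br) (twist_tr \<beta> tr) \<beta>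
        scale' V' (twist_br \<beta>' br') (twist_tr \<beta>' tr') \<beta>' f)"
  using assms(3-5) by (blast intro: hom_bol_superalgebra_twist hom_bol_morphism_twist)

end
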